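(* Let $A\in\mathcal{M}_n(\mathbb{C})$ be a diagonal matrix with $k$-th diagonal entry equal to $a_k\in\mathbb{C}$ for $k=1,\ldots,n$, and let $B=hJ_m$, where $h\in\mathbb{C}$ and $J_m$ is the $m\times m$ matrix with all entries equal to $1$. Then the spectrum of $A\wr B$ is $$\bigcup_{(i_1,\ldots,i_n)\in\{0,\ldots,m-1\}^n}\ \bigcup_{k=1}^n\left\{a_k+h\sum_{j=0}^{m-1}\rho^{j\,i_k}\right\},\qquad \rho=\exp\left(\frac{2\pi i}{m}\right),\ i=\sqrt{-1},$$ and therefore $$\det(A\wr B)=\prod_{k=1}^n (a_k+mh)^{m^{n-1}}\cdot a_k^{(m-1)m^{n-1}}.$$
   Context: $n,m$ are positive integers. Wreath product of matrices: for $A\in\mathcal{M}_n(\mathbb{C})$ and $B\in\mathcal{M}_m(\mathbb{C})$, $$A\wr B = I_m^{\otimes n}\otimes A+\sum_{i=1}^n I_m^{\otimes (i-1)}\otimes B\otimes I_m^{\otimes (n-i)}\otimes C_i,$$ a square matrix of order $nm^n$. Here $\otimes$ is the Kronecker product, $I_m^{\otimes r}$ is the $r$-fold Kronecker power, with $I_m^{\otimes 0}=1$, and $C_i\in\mathcal{M}_n(\mathbb{C})$ has entry $1$ in position $(i,i)$ and $0$ elsewhere. Spectra are multisets of eigenvalues counted with algebraic multiplicity, and unions add multiplicities. The convention $0^0=1$ is used. *)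

theory Defs
  imports "Jordan_Normal_Form.Char_Poly" "HOL-Library.FuncSet" "HOL-Computational_Algebra.Polynomial"
begin

definition kron_mat :: "'a :: times mat \<Rightarrow> 'a mat \<Rightarrow> 'a mat" (infixl \<open>\<otimes>\<^sub>m\<close> 75) where
  "A \<otimes>\<^sub>m B = mat (dim_row A * dim_row B) (dim_col A * dim_col B)
     (\<lambda>(i, j). A $$ (i div dim_row B, j div dim_col B) * B $$ (i mod dim_row B, j mod dim_col B))"

primrec kron_pow :: "'a :: semiring_1 mat \<Rightarrow> nat \<Rightarrow> 'a mat" where
  "kron_pow A 0 = 1\<^sub>m 1"
| "kron_pow A (Suc r) = kron_pow A r \<otimes>\<^sub>m A"

definition diag_unit_mat :: "nat \<Rightarrow> nat \<Rightarrow> 'a :: semiring_1 mat" where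
  "diag_unit_mat n i = mat n n (\<lambda>(r, c). if r = i \<and> c = i then 1 else 0)"

definition all_ones_mat :: "nat \<Rightarrow> 'a :: semiring_1 mat" where
  "all_ones_mat m = mat m m (\<lambda>_. 1)"

text \<open>Rows and columns are numbered from \<open>0\<close>, so the summation index \<open>i < n\<close> is the usual
  \<open>i \<in> {1..n}\<close> shifted by one. The definition is meant for square matrices. Type
  \<^typ>\<open>'a mat\<close> does not fix dimensions and has no additive monoid structure, hence the sum is taken
  in the module of square matrices of order \<open>n * m ^ n\<close>.\<close>

definition wreath_mat :: "'a :: comm_ring_1 mat \<Rightarrow> 'a mat \<Rightarrow> 'a mat" where
  "wreath_mat A B = (let n = dim_row A; m = dim_row B; N = n * m ^ n in
     kron_pow (1\<^sub>m m) n \<otimes>\<^sub>m A +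
     finsum (module_mat TYPE('a) N N)
       (\<lambda>i. kron_pow (1\<^sub>m m) i \<otimes>\<^sub>m B \<otimes>\<^sub>m kron_pow (1\<^sub>m m) (n - 1 - i) \<otimes>\<^sub>m diag_unit_mat n i)
       {..<n})"

definition spectrum_mset :: "'a :: idom mat \<Rightarrow> 'a multiset" where
  "spectrum_mset A = proots (char_poly A)"

lemma kron_mat_carrier:
  "A \<in> carrier_mat a b \<Longrightarrow> B \<in> carrier_mat c d \<Longrightarrow> A \<otimes>\<^sub>m B \<in> carrier_mat (a * c) (b * d)"
  by (auto simp: kron_mat_def)

lemma kron_pow_carrier: "A \<in> carrier_mat a b \<Longrightarrow> kron_pow A r \<in> carrier_mat (a ^ r) (b ^ r)"
proof (induction r)
  case (Suc r)
  then show ?case using kron_mat_carrier[of "kron_pow A r" "a ^ r" "b ^ r" A a b]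
    by (simp add: mult.commute)
qed simp

lemma diag_unit_mat_carrier: "diag_unit_mat n i \<in> carrier_mat n n"
  by (simp add: diag_unit_mat_def)

lemma wreath_summand_carrier:
  assumes "B \<in> carrier_mat m m" "i < n"
  shows "kron_pow (1\<^sub>m m) i \<otimes>\<^sub>m B \<otimes>\<^sub>m kron_pow (1\<^sub>m m) (n - 1 - i) \<otimes>\<^sub>m diag_unit_mat n i
           \<in> carrier_mat (n * m ^ n) (n * m ^ n)"
proof -
  have "m ^ n = m ^ i * m * m ^ (n - 1 - i)"
    using assms(2) power_add[of m "Suc i" "n - 1 - i"] by (simp add: mult.commute)
  then show ?thesis
    using kron_mat_carrier[OF kron_mat_carrier[OF kron_mat_carrier[OF
        kron_pow_carrier[OF one_carrier_mat[of m], of i] assms(1)]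
        kron_pow_carrier[OF one_carrier_mat[of m], of "n - 1 - i"]] diag_unit_mat_carrier[of n i]]
    by (simp add: mult.commute)
qed

lemma wreath_mat_carrier:
  fixes A B :: "'a :: comm_ring_1 mat"
  assumes A: "A \<in> carrier_mat n n" and B: "B \<in> carrier_mat m m"
  shows "wreath_mat A B \<in> carrier_mat (n * m ^ n) (n * m ^ n)"
proof -
  let ?M = "module_mat TYPE('a) (n * m ^ n) (n * m ^ n)"
  interpret abelian_group ?M by (rule abelian_group_mat)
  have "finsum ?M
       (\<lambda>i. kron_pow (1\<^sub>m m) i \<otimes>\<^sub>m B \<otimes>\<^sub>m kron_pow (1\<^sub>m m) (n - 1 - i) \<otimes>\<^sub>m diag_unit_mat n i)
       {..<n} \<in> carrier ?M"
    by (rule finsum_closed) (use wreath_summand_carrier[OF B] in \<open>auto simp: module_mat_simps\<close>)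
  then show ?thesis using A B unfolding wreath_mat_def by (simp add: Let_def module_mat_simps)
qed

end

(*
  If P diagonalises B, then conjugating by the n-fold Kronecker power of P, tensored with I_n,
  turns the wreath product of A and B into that of A and D = P^-1 B P: by the mixed-product rule
  every summand is conjugated factor by factor, and the factors A and C_i are left alone.
  For B = hJ the discrete Fourier matrix is such a P. When A and D are both diagonal the wreath
  product is diagonal, and its entry at the position with base-m digits (x_1, ..., x_n) and last
  index k is a_k + d_(x_k).
*)
theory Submission
  imports "HOL-Analysis.Complex_Transcendental" Defs
begin

section \<open>Index pairs encoded by division with remainder\<close>

lemma div_mod_less_of_less_mult:
  fixes i a b :: nat
  assumes "i < a * b"
  shows "i div b < a" "i mod b < b"
proof -
  have "b > 0" using assms by (cases b) auto
  then show "i div b < a" "i mod b < b" using assms by (auto simp: less_mult_imp_div_less)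
qed

lemma bij_betw_div_mod:
  "bij_betw (\<lambda>i. (i div b, i mod b)) {..<a * b} ({..<a} \<times> {..<(b :: nat)})"
proof (rule bij_betw_byWitness[where f' = "\<lambda>(x, y). x * b + y"])
  show "(\<lambda>(x, y). x * b + y) ` ({..<a} \<times> {..<b}) \<subseteq> {..<a * b}"
  proof clarsimp
    fix x y assume "x < a" "y < b"
    then have "x * b + y < x * b + b" by simp
    also have "\<dots> = Suc x * b" by simp
    also have "\<dots> \<le> a * b" using \<open>x < a\<close> by (intro mult_le_mono1) simp
    finally show "x * b + y < a * b" .
  qed
qed (auto simp: div_mod_less_of_less_mult)

text \<open>Splits both kinds of sum met below: over the inner index of a product of Kronecker
  products, and over the diagonal positions of a wreath product.\<close>

lemma sum_div_mod:
  fixes f :: "nat \<Rightarrow> nat \<Rightarrow> 'a :: comm_monoid_add"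
  shows "(\<Sum>i<a * b. f (i div b) (i mod b)) = (\<Sum>x<a. \<Sum>y<b. f x y)"
  using sum.reindex_bij_betw[OF bij_betw_div_mod, of "\<lambda>(x, y). f x y" b a]
  by (simp add: sum.cartesian_product)

section \<open>Algebra of the Kronecker product\<close>

lemma dim_kron_mat [simp]:
  "dim_row (A \<otimes>\<^sub>m B) = dim_row A * dim_row B"
  "dim_col (A \<otimes>\<^sub>m B) = dim_col A * dim_col B"
  by (simp_all add: kron_mat_def)

lemma index_kron_mat:
  assumes "i < dim_row A * dim_row B" "j < dim_col A * dim_col B"
  shows "(A \<otimes>\<^sub>m B) $$ (i, j) = A $$ (i div dim_row B, j div dim_col B) * B $$ (i mod dim_row B, j mod dim_col B)"
  using assms by (simp add: kron_mat_def)

text \<open>Both bracketings cut an index into the same three mixed-radix digits, whose radices are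
  the dimensions of the factors. The fact \<open>*\<close> reconciles the two ways of extracting
  them; what is left is associativity of the entries.\<close>

lemma kron_mat_assoc:
  fixes A B C :: "'a :: semigroup_mult mat"
  shows "A \<otimes>\<^sub>m B \<otimes>\<^sub>m C = A \<otimes>\<^sub>m (B \<otimes>\<^sub>m C)"
proof (rule eq_matI)
  fix i j assume "i < dim_row (A \<otimes>\<^sub>m (B \<otimes>\<^sub>m C))" "j < dim_col (A \<otimes>\<^sub>m (B \<otimes>\<^sub>m C))"
  then have i: "i < dim_row A * dim_row B * dim_row C" and j: "j < dim_col A * dim_col B * dim_col C"
    by (simp_all add: mult.assoc)
  have *: "k div (b * c) = k div c div b" "k mod (b * c) div c = k div c mod b"
    "k mod (b * c) mod c = k mod c" if "k < a * b * c" for a b c k :: nat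
  proof -
    have "k mod c < c" using that by (rule div_mod_less_of_less_mult)
    then show "k mod (b * c) div c = k div c mod b"
      by (simp add: mult.commute[of b c] mod_mult2_eq)
    show "k div (b * c) = k div c div b" by (simp add: mult.commute[of b c] div_mult2_eq)
    show "k mod (b * c) mod c = k mod c" by (simp add: mod_mod_cancel)
  qed
  show "(A \<otimes>\<^sub>m B \<otimes>\<^sub>m C) $$ (i, j) = (A \<otimes>\<^sub>m (B \<otimes>\<^sub>m C)) $$ (i, j)"
    using i j div_mod_less_of_less_mult[OF i] div_mod_less_of_less_mult[OF j]
      div_mod_less_of_less_mult[of i "dim_row A" "dim_row B * dim_row C"]
      div_mod_less_of_less_mult[of j "dim_col A" "dim_col B * dim_col C"]
    by (simp add: index_kron_mat * mult.assoc)
qed (simp_all add: mult.assoc)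

text \<open>The mixed-product rule. Splitting the inner summation index into quotient and remainder
  turns the sum into a double sum that factors, once commutativity has gathered the entries of
  \<open>A\<close> and \<open>C\<close> on one side and those of \<open>B\<close> and
  \<open>D\<close> on the other.\<close>

lemma kron_mat_mult:
  fixes A B C D :: "'a :: comm_semiring_0 mat"
  assumes A: "A \<in> carrier_mat a b" and C: "C \<in> carrier_mat b c"
    and B: "B \<in> carrier_mat d e" and D: "D \<in> carrier_mat e f"
  shows "(A \<otimes>\<^sub>m B) * (C \<otimes>\<^sub>m D) = (A * C) \<otimes>\<^sub>m (B * D)"
proof (rule eq_matI)
  fix i j assume "i < dim_row ((A * C) \<otimes>\<^sub>m (B * D))" "j < dim_col ((A * C) \<otimes>\<^sub>m (B * D))"
  then have i: "i < a * d" and j: "j < c * f" using assms by auto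
  note ij = div_mod_less_of_less_mult[OF i] div_mod_less_of_less_mult[OF j]
  have "((A \<otimes>\<^sub>m B) * (C \<otimes>\<^sub>m D)) $$ (i, j) = (\<Sum>k<b * e. (A \<otimes>\<^sub>m B) $$ (i, k) * (C \<otimes>\<^sub>m D) $$ (k, j))"
    using assms i j by (simp add: scalar_prod_def lessThan_atLeast0)
  also have "\<dots> = (\<Sum>k<b * e. (A $$ (i div d, k div e) * C $$ (k div e, j div f)) *
      (B $$ (i mod d, k mod e) * D $$ (k mod e, j mod f)))"
    using assms i j by (intro sum.cong refl) (auto simp: index_kron_mat mult_ac)
  also have "\<dots> = (\<Sum>x<b. \<Sum>y<e. (A $$ (i div d, x) * C $$ (x, j div f)) *
      (B $$ (i mod d, y) * D $$ (y, j mod f)))"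
    by (rule sum_div_mod)
  also have "\<dots> = (A * C) $$ (i div d, j div f) * (B * D) $$ (i mod d, j mod f)"
    using assms ij by (simp add: scalar_prod_def lessThan_atLeast0 sum_product)
  also have "\<dots> = ((A * C) \<otimes>\<^sub>m (B * D)) $$ (i, j)"
    using assms i j by (simp add: index_kron_mat)
  finally show "((A \<otimes>\<^sub>m B) * (C \<otimes>\<^sub>m D)) $$ (i, j) = ((A * C) \<otimes>\<^sub>m (B * D)) $$ (i, j)" .
qed (use assms in auto)

lemma kron_mat_one: "1\<^sub>m a \<otimes>\<^sub>m 1\<^sub>m b = (1\<^sub>m (a * b) :: 'a :: semiring_1 mat)"
proof (rule eq_matI)
  fix i j assume "i < dim_row (1\<^sub>m (a * b))" "j < dim_col (1\<^sub>m (a * b))"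
  then have i: "i < a * b" and j: "j < a * b" by auto
  have "i = j \<longleftrightarrow> i div b = j div b \<and> i mod b = j mod b" by (metis div_mult_mod_eq)
  then show "(1\<^sub>m a \<otimes>\<^sub>m 1\<^sub>m b) $$ (i, j) = (1\<^sub>m (a * b) :: 'a mat) $$ (i, j)"
    using i j div_mod_less_of_less_mult[OF i] div_mod_less_of_less_mult[OF j]
    by (auto simp: index_kron_mat)
qed auto

lemma kron_mat_one_right [simp]: "A \<otimes>\<^sub>m 1\<^sub>m 1 = (A :: 'a :: semiring_1 mat)"
  by (rule eq_matI) (auto simp: index_kron_mat)

lemma diagonal_mat_kron_mat:
  fixes A B :: "'a :: semiring_0 mat"
  assumes "diagonal_mat A" "diagonal_mat B" "A \<in> carrier_mat a a" "B \<in> carrier_mat b b"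
  shows "diagonal_mat (A \<otimes>\<^sub>m B)"
  unfolding diagonal_mat_def
proof (intro allI impI)
  fix i j assume "i < dim_row (A \<otimes>\<^sub>m B)" "j < dim_col (A \<otimes>\<^sub>m B)" and ne: "i \<noteq> j"
  then have i: "i < a * b" and j: "j < a * b" using assms by auto
  have "i div b \<noteq> j div b \<or> i mod b \<noteq> j mod b" using ne by (metis div_mult_mod_eq)
  then have "A $$ (i div b, j div b) = 0 \<or> B $$ (i mod b, j mod b) = 0"
    using assms div_mod_less_of_less_mult[OF i] div_mod_less_of_less_mult[OF j]
    by (metis carrier_matD diagonal_mat_def)
  then show "(A \<otimes>\<^sub>m B) $$ (i, j) = 0"
    using assms i j by (auto simp: index_kron_mat)
qed

section \<open>Kronecker powers and factorwise conjugation\<close>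

lemma kron_pow_add:
  "kron_pow (A :: 'a :: semiring_1 mat) (r + s) = kron_pow A r \<otimes>\<^sub>m kron_pow A s"
  by (induction s) (simp_all add: kron_mat_assoc del: One_nat_def)

text \<open>Brings a power of the conjugating matrix into the shape of the \<open>i\<close>-th
  wreath summand, with its factor in position \<open>i\<close> singled out.\<close>

lemma kron_pow_split:
  assumes "i < n"
  shows "kron_pow (A :: 'a :: semiring_1 mat) n = kron_pow A i \<otimes>\<^sub>m A \<otimes>\<^sub>m kron_pow A (n - 1 - i)"
  using kron_pow_add[of A "Suc i" "n - 1 - i"] assms by simp

lemma kron_pow_one: "kron_pow (1\<^sub>m m) r = (1\<^sub>m (m ^ r) :: 'a :: semiring_1 mat)"
  by (induction r) (simp_all add: kron_mat_one mult.commute)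

lemma kron_pow_mult:
  fixes A B :: "'a :: comm_semiring_1 mat"
  assumes "A \<in> carrier_mat m m" "B \<in> carrier_mat m m"
  shows "kron_pow A r * kron_pow B r = kron_pow (A * B) r"
proof (induction r)
  case (Suc r)
  have "kron_pow A (Suc r) * kron_pow B (Suc r) = (kron_pow A r * kron_pow B r) \<otimes>\<^sub>m (A * B)"
    using kron_mat_mult[OF kron_pow_carrier[OF assms(1)] kron_pow_carrier[OF assms(2)] assms] by simp
  then show ?case using Suc by simp
qed simp

text \<open>Two uses of the mixed-product rule. Iterated, it lets a conjugation reach every factor
  of a wreath summand separately.\<close>

lemma kron_mat_conj:
  fixes P P' Q Q' X Y :: "'a :: comm_semiring_1 mat"
  assumes "P \<in> carrier_mat a a" "X \<in> carrier_mat a a" "Q \<in> carrier_mat a a"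
    and "P' \<in> carrier_mat b b" "Y \<in> carrier_mat b b" "Q' \<in> carrier_mat b b"
  shows "(P \<otimes>\<^sub>m P') * (X \<otimes>\<^sub>m Y) * (Q \<otimes>\<^sub>m Q') = (P * X * Q) \<otimes>\<^sub>m (P' * Y * Q')"
proof -
  have "(P \<otimes>\<^sub>m P') * (X \<otimes>\<^sub>m Y) = (P * X) \<otimes>\<^sub>m (P' * Y)"
    using assms by (intro kron_mat_mult)
  moreover have "((P * X) \<otimes>\<^sub>m (P' * Y)) * (Q \<otimes>\<^sub>m Q') = (P * X * Q) \<otimes>\<^sub>m (P' * Y * Q')"
    using assms by (intro kron_mat_mult) auto
  ultimately show ?thesis by simp
qed

section \<open>Finite sums in the module of matrices\<close>

lemma index_finsum_mat:
  fixes f :: "'b \<Rightarrow> 'a :: comm_ring_1 mat"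
  assumes "finite S" "\<And>s. s \<in> S \<Longrightarrow> f s \<in> carrier_mat nr nc" "i < nr" "j < nc"
  shows "finsum (module_mat TYPE('a) nr nc) f S $$ (i, j) = (\<Sum>s\<in>S. f s $$ (i, j))"
proof -
  interpret abelian_group "module_mat TYPE('a) nr nc" by (rule abelian_group_mat)
  show ?thesis using assms(1,2)
  proof (induction S rule: finite_induct)
    case empty
    then show ?case using assms(3,4) by (simp add: module_mat_simps)
  next
    case (insert x S)
    have f: "f \<in> S \<rightarrow> carrier (module_mat TYPE('a) nr nc)" "f x \<in> carrier (module_mat TYPE('a) nr nc)"
      using insert.prems by (auto simp: module_mat_simps)
    have "finsum (module_mat TYPE('a) nr nc) f S \<in> carrier_mat nr nc"
      using finsum_closed[OF f(1)] by (simp add: module_mat_simps)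
    then show ?case
      using insert f assms(3,4) by (simp add: finsum_insert) (simp add: module_mat_simps)
  qed
qed

text \<open>Moves the conjugation inside the sum of the wreath product by distributivity, so that
  each summand can be treated on its own.\<close>

lemma conj_finsum_mat:
  fixes f :: "'b \<Rightarrow> 'a :: comm_ring_1 mat"
  assumes "finite S" "\<And>s. s \<in> S \<Longrightarrow> f s \<in> carrier_mat N N"
    and P: "P \<in> carrier_mat N N" and Q: "Q \<in> carrier_mat N N"
  shows "P * finsum (module_mat TYPE('a) N N) f S * Q = finsum (module_mat TYPE('a) N N) (\<lambda>s. P * f s * Q) S"
proof -
  interpret abelian_group "module_mat TYPE('a) N N" by (rule abelian_group_mat)
  show ?thesis using assms(1,2)
  proof (induction S rule: finite_induct)
    case empty
    then show ?case using P Q by (simp add: module_mat_simps)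
  next
    case (insert x S)
    let ?M = "module_mat TYPE('a) N N"
    have f: "f \<in> S \<rightarrow> carrier ?M" "f x \<in> carrier ?M"
      using insert.prems by (auto simp: module_mat_simps)
    have g: "(\<lambda>s. P * f s * Q) \<in> S \<rightarrow> carrier ?M" "P * f x * Q \<in> carrier ?M"
      using insert.prems P Q by (auto simp: module_mat_simps)
    have c: "finsum ?M f S \<in> carrier_mat N N" "f x \<in> carrier_mat N N"
      using finsum_closed[OF f(1)] f(2) by (simp_all add: module_mat_simps)
    have "P * (f x + finsum ?M f S) * Q = P * f x * Q + P * finsum ?M f S * Q"
      using c P Q by (simp add: mult_add_distrib_mat[of _ N N] add_mult_distrib_mat[of _ N N])
    then show ?case
      using insert f g by (simp add: finsum_insert) (simp add: module_mat_simps)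
  qed
qed

section \<open>Similarity of wreath products in their second argument\<close>

lemma similar_mat_wreath_mat:
  fixes A B D :: "'a :: comm_ring_1 mat"
  assumes A: "A \<in> carrier_mat n n" and B: "B \<in> carrier_mat m m" and sim: "similar_mat B D"
  shows "similar_mat (wreath_mat A B) (wreath_mat A D)"
proof -
  obtain P Q where "similar_mat_wit B D P Q" using sim unfolding similar_mat_def by blast
  then have PQ: "P * Q = 1\<^sub>m m" "Q * P = 1\<^sub>m m" "B = P * D * Q"
    and D: "D \<in> carrier_mat m m" and P: "P \<in> carrier_mat m m" and Q: "Q \<in> carrier_mat m m"
    by (fact similar_mat_witD2[OF B])+
  define N where "N = n * m ^ n"
  define S where "S = kron_pow P n \<otimes>\<^sub>m 1\<^sub>m n"
  define T where "T = kron_pow Q n \<otimes>\<^sub>m 1\<^sub>m n"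
  note pow = kron_pow_carrier[OF P] kron_pow_carrier[OF Q] kron_pow_carrier[OF one_carrier_mat, of m]
  have ST: "S \<in> carrier_mat N N" "T \<in> carrier_mat N N"
    using kron_mat_carrier[OF pow(1)[of n] one_carrier_mat[of n]]
      kron_mat_carrier[OF pow(2)[of n] one_carrier_mat[of n]]
    by (simp_all add: S_def T_def N_def mult.commute)
  have inv: "S * T = 1\<^sub>m N" "T * S = 1\<^sub>m N"
    unfolding S_def T_def
    by (subst kron_mat_mult[OF pow(1) pow(2) one_carrier_mat one_carrier_mat],
        simp add: kron_pow_mult[OF P Q] PQ kron_pow_one kron_mat_one N_def mult.commute)
       (subst kron_mat_mult[OF pow(2) pow(1) one_carrier_mat one_carrier_mat],
        simp add: kron_pow_mult[OF Q P] PQ kron_pow_one kron_mat_one N_def mult.commute)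
  have powPQ: "kron_pow P r * kron_pow (1\<^sub>m m) r * kron_pow Q r = kron_pow (1\<^sub>m m) r" for r
    using P Q PQ by (simp add: kron_pow_mult[OF P] kron_pow_mult[OF P Q])
  define F where "F X i = kron_pow (1\<^sub>m m) i \<otimes>\<^sub>m X \<otimes>\<^sub>m kron_pow (1\<^sub>m m) (n - 1 - i) \<otimes>\<^sub>m diag_unit_mat n i"
    for X :: "'a mat" and i
  let ?M = "module_mat TYPE('a) N N"
  have Fc: "F X i \<in> carrier_mat N N" if "i < n" "X \<in> carrier_mat m m" for X i
    unfolding F_def N_def using wreath_summand_carrier[OF that(2,1)] .
  have conjF: "S * F D i * T = F B i" if "i < n" for i
  proof -
    \<comment> \<open>The carriers \<open>c1\<close> and \<open>c2\<close> follow the left-nested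
      bracketing of a summand. They allow \<open>kron_mat_conj\<close> to peel off factors from the
      right: first \<open>diag_unit_mat n i\<close>, then the trailing power, then the factor
      \<open>D\<close>.\<close>
    have c1: "kron_pow X i \<otimes>\<^sub>m Y \<in> carrier_mat (m ^ i * m) (m ^ i * m)"
      if "X \<in> carrier_mat m m" "Y \<in> carrier_mat m m" for X Y :: "'a mat"
      by (rule kron_mat_carrier[OF kron_pow_carrier[OF that(1)] that(2)])
    have c2: "kron_pow X i \<otimes>\<^sub>m Y \<otimes>\<^sub>m kron_pow X (n - 1 - i)
        \<in> carrier_mat (m ^ i * m * m ^ (n - 1 - i)) (m ^ i * m * m ^ (n - 1 - i))"
      if "X \<in> carrier_mat m m" "Y \<in> carrier_mat m m" for X Y :: "'a mat"
      by (rule kron_mat_carrier[OF c1[OF that] kron_pow_carrier[OF that(1)]])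
    have "S * F D i * T =
      (kron_pow P i * kron_pow (1\<^sub>m m) i * kron_pow Q i) \<otimes>\<^sub>m (P * D * Q) \<otimes>\<^sub>m
      (kron_pow P (n - 1 - i) * kron_pow (1\<^sub>m m) (n - 1 - i) * kron_pow Q (n - 1 - i)) \<otimes>\<^sub>m
      (1\<^sub>m n * diag_unit_mat n i * 1\<^sub>m n)"
      unfolding S_def T_def F_def kron_pow_split[OF that, of P] kron_pow_split[OF that, of Q]
      by (subst kron_mat_conj[OF c2[OF P P] c2[OF one_carrier_mat D] c2[OF Q Q]
              one_carrier_mat diag_unit_mat_carrier one_carrier_mat],
          subst kron_mat_conj[OF c1[OF P P] c1[OF one_carrier_mat D] c1[OF Q Q] pow(1) pow(3) pow(2)],
          subst kron_mat_conj[OF pow(1) pow(3) pow(2) P D Q]) (rule refl)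
    also have "\<dots> = F B i"
      by (simp only: powPQ PQ(3)[symmetric] F_def left_mult_one_mat[OF diag_unit_mat_carrier]
          right_mult_one_mat[OF diag_unit_mat_carrier])
    finally show ?thesis .
  qed
  \<comment> \<open>\<open>S\<close> and \<open>T\<close> act on the last factor as the identity,
    and the remaining factors are identity matrices, which conjugation fixes by
    \<open>powPQ\<close>.\<close>
  have conjA: "S * (kron_pow (1\<^sub>m m) n \<otimes>\<^sub>m A) * T = kron_pow (1\<^sub>m m) n \<otimes>\<^sub>m A"
    unfolding S_def T_def
    by (subst kron_mat_conj[OF pow(1) pow(3) pow(2) one_carrier_mat A one_carrier_mat])
       (use A in \<open>simp add: powPQ\<close>)
  have W: "wreath_mat A X = kron_pow (1\<^sub>m m) n \<otimes>\<^sub>m A + finsum ?M (F X) {..<n}"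
    if "X \<in> carrier_mat m m" for X
    using A that unfolding wreath_mat_def F_def N_def by (simp add: Let_def)
  interpret abelian_group ?M by (rule abelian_group_mat)
  have sumc: "finsum ?M (F D) {..<n} \<in> carrier_mat N N"
    using finsum_closed[of "F D" "{..<n}"] Fc[OF _ D] by (auto simp: module_mat_simps)
  have Ac: "kron_pow (1\<^sub>m m) n \<otimes>\<^sub>m A \<in> carrier_mat N N"
    using kron_mat_carrier[OF pow(3)[of n] A] by (simp add: N_def mult.commute)
  have "S * finsum ?M (F D) {..<n} * T = finsum ?M (\<lambda>i. S * F D i * T) {..<n}"
    using Fc[OF _ D] ST by (intro conj_finsum_mat) auto
  also have "\<dots> = finsum ?M (F B) {..<n}"
    by (rule finsum_cong') (use Fc[OF _ B] conjF in \<open>auto simp: module_mat_simps\<close>)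
  finally have "S * wreath_mat A D * T = wreath_mat A B"
    using ST sumc Ac unfolding W[OF D] W[OF B]
    by (simp add: mult_add_distrib_mat[of _ N N] add_mult_distrib_mat[of _ N N] conjA)
  then have "similar_mat_wit (wreath_mat A B) (wreath_mat A D) S T"
    using ST inv wreath_mat_carrier[OF A B] wreath_mat_carrier[OF A D]
    by (intro similar_mat_witI[of _ _ N]) (simp_all add: N_def)
  then show ?thesis unfolding similar_mat_def by blast
qed

section \<open>Wreath products of diagonal matrices\<close>

lemma wreath_mat_diagonal:
  fixes A D :: "'a :: comm_ring_1 mat"
  assumes A: "A \<in> carrier_mat n n" "diagonal_mat A" and D: "D \<in> carrier_mat m m" "diagonal_mat D"
  shows "diagonal_mat (wreath_mat A D)"
    and "p < n * m ^ n \<Longrightarrow> wreath_mat A D $$ (p, p) =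
           A $$ (p mod n, p mod n) +
           D $$ (p div n div m ^ (n - 1 - p mod n) mod m, p div n div m ^ (n - 1 - p mod n) mod m)"
proof -
  define N where "N = n * m ^ n"
  define F where "F i = kron_pow (1\<^sub>m m) i \<otimes>\<^sub>m D \<otimes>\<^sub>m kron_pow (1\<^sub>m m) (n - 1 - i) \<otimes>\<^sub>m diag_unit_mat n i"
    for i
  have Fc: "F i \<in> carrier_mat N N" if "i < n" for i
    unfolding F_def N_def using wreath_summand_carrier[OF D(1) that] .
  have diag1: "diagonal_mat (1\<^sub>m k :: 'a mat)" "diagonal_mat (diag_unit_mat k i :: 'a mat)" for k i
    by (auto simp: diagonal_mat_def diag_unit_mat_def)
  have Fd: "diagonal_mat (F i)" for i
    unfolding F_def kron_pow_one
    by (rule diagonal_mat_kron_mat diag1 D kron_mat_carrier one_carrier_mat diag_unit_mat_carrier)+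
  have Ad: "diagonal_mat (kron_pow (1\<^sub>m m) n \<otimes>\<^sub>m A)"
    unfolding kron_pow_one by (rule diagonal_mat_kron_mat diag1 A one_carrier_mat)+
  have Ac: "kron_pow (1\<^sub>m m) n \<otimes>\<^sub>m A \<in> carrier_mat N N"
    using kron_mat_carrier[OF kron_pow_carrier[OF one_carrier_mat, of m n] A(1)]
    by (simp add: N_def mult.commute)
  let ?M = "module_mat TYPE('a) N N"
  interpret abelian_group ?M by (rule abelian_group_mat)
  have sumc: "finsum ?M F {..<n} \<in> carrier_mat N N"
    using finsum_closed[of F "{..<n}"] Fc by (auto simp: module_mat_simps)
  have W: "wreath_mat A D = kron_pow (1\<^sub>m m) n \<otimes>\<^sub>m A + finsum ?M F {..<n}"
    using A D unfolding wreath_mat_def F_def N_def by (simp add: Let_def)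
  have idx: "wreath_mat A D $$ (p, q) = (kron_pow (1\<^sub>m m) n \<otimes>\<^sub>m A) $$ (p, q) + (\<Sum>i<n. F i $$ (p, q))"
    if "p < N" "q < N" for p q
    using that sumc Ac Fc index_finsum_mat[of "{..<n}" F N N p q] unfolding W by simp
  show "diagonal_mat (wreath_mat A D)"
    unfolding diagonal_mat_def
  proof (intro allI impI)
    fix p q assume "p < dim_row (wreath_mat A D)" "q < dim_col (wreath_mat A D)" and ne: "p \<noteq> q"
    then have pq: "p < N" "q < N" using wreath_mat_carrier[OF A(1) D(1)] by (auto simp: N_def)
    have "(\<Sum>i<n. F i $$ (p, q)) = 0"
      using Fd Fc pq ne by (intro sum.neutral) (metis carrier_matD diagonal_mat_def lessThan_iff)
    moreover have "(kron_pow (1\<^sub>m m) n \<otimes>\<^sub>m A) $$ (p, q) = 0"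
      using Ad Ac pq ne by (metis carrier_matD diagonal_mat_def)
    ultimately show "wreath_mat A D $$ (p, q) = 0" using pq by (simp add: idx)
  qed
  \<comment> \<open>The remainder of \<open>p\<close> modulo \<open>n\<close> indexes
    \<open>A\<close>. The quotient carries \<open>n\<close> digits in base \<open>m\<close>, most
    significant first, so the digit with number \<open>i\<close>, counted from 0, is reached by
    dividing by \<open>m ^ (n - 1 - i)\<close>.\<close>
  assume "p < n * m ^ n"
  then have p: "p < N" "p < m ^ n * n" by (simp_all add: N_def mult.commute)
  note dm = div_mod_less_of_less_mult[OF p(2)]
  \<comment> \<open>The factor \<open>diag_unit_mat n i\<close> kills every summand except the one
    with \<open>i = p mod n\<close>. In that one the identity factors contribute 1 and
    \<open>D\<close> is evaluated at its own digit.\<close>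
  have Fp: "F i $$ (p, p) = (if i = p mod n then
      D $$ (p div n div m ^ (n - 1 - i) mod m, p div n div m ^ (n - 1 - i) mod m) else 0)"
    if "i < n" for i
  proof -
    have split: "m ^ n = m ^ i * m * m ^ (n - 1 - i)"
      using that power_add[of m "Suc i" "n - 1 - i"] by (simp add: mult.commute)
    have l1: "p div n < m ^ i * m * m ^ (n - 1 - i)" using dm split by simp
    note l2 = div_mod_less_of_less_mult[OF l1]
    note l3 = div_mod_less_of_less_mult[OF l2(1)]
    define X where "X = kron_pow (1\<^sub>m m) i \<otimes>\<^sub>m D \<otimes>\<^sub>m kron_pow (1\<^sub>m m) (n - 1 - i)"
    have X: "X \<in> carrier_mat (m ^ n) (m ^ n)"
      using D(1) unfolding X_def split by (intro kron_mat_carrier kron_pow_carrier one_carrier_mat)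
    have "X $$ (p div n, p div n) =
       D $$ (p div n div m ^ (n - 1 - i) mod m, p div n div m ^ (n - 1 - i) mod m)"
      using l1 l2 l3 D(1) by (simp add: X_def kron_pow_one index_kron_mat)
    moreover have "F i $$ (p, p) = X $$ (p div n, p div n) * diag_unit_mat n i $$ (p mod n, p mod n)"
      using p X diag_unit_mat_carrier[of n i]
      unfolding F_def X_def[symmetric] by (subst index_kron_mat) (auto simp: diag_unit_mat_def)
    moreover have "(diag_unit_mat n i :: 'a mat) $$ (p mod n, p mod n) = (if i = p mod n then 1 else 0)"
      using dm by (simp add: diag_unit_mat_def)
    ultimately show ?thesis by simp
  qed
  have "(kron_pow (1\<^sub>m m) n \<otimes>\<^sub>m A) $$ (p, p) = A $$ (p mod n, p mod n)"
    using p dm A(1) by (simp add: kron_pow_one index_kron_mat)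
  moreover have "(\<Sum>i<n. F i $$ (p, p)) =
      D $$ (p div n div m ^ (n - 1 - p mod n) mod m, p div n div m ^ (n - 1 - p mod n) mod m)"
    using dm by (simp add: Fp)
  ultimately show "wreath_mat A D $$ (p, p) =
           A $$ (p mod n, p mod n) +
           D $$ (p div n div m ^ (n - 1 - p mod n) mod m, p div n div m ^ (n - 1 - p mod n) mod m)"
    using p by (simp add: idx)
qed

section \<open>Base-\<open>m\<close> digits and the multiset of diagonal entries\<close>

lemma eq_of_digits_eq:
  fixes x y m :: nat
  assumes "x < m ^ n" "y < m ^ n" "\<And>i. i < n \<Longrightarrow> x div m ^ i mod m = y div m ^ i mod m"
  shows "x = y"
  using assms
proof (induction n arbitrary: x y)
  case (Suc n)
  have "x div m = y div m"
  proof (rule Suc.IH)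
    show "x div m < m ^ n" "y div m < m ^ n"
      using Suc.prems(1,2) by (simp_all add: less_mult_imp_div_less mult.commute)
    show "x div m div m ^ i mod m = y div m div m ^ i mod m" if "i < n" for i
      using Suc.prems(3)[of "Suc i"] that by (simp add: div_mult2_eq)
  qed
  moreover have "x mod m = y mod m" using Suc.prems(3)[of 0] by simp
  ultimately show ?case by (metis div_mult_mod_eq)
qed simp

text \<open>Injectivity is uniqueness of the base-\<open>m\<close> expansion; surjectivity follows
  by counting, as both sets have \<open>m ^ n\<close> elements. The exponent
  \<open>n - 1 - i\<close> reads the digits from the most significant one, as the diagonal of the
  wreath product does.\<close>

lemma bij_betw_digits:
  fixes m n :: nat
  assumes "m > 0"
  shows "bij_betw (\<lambda>x. \<lambda>i\<in>{..<n}. x div m ^ (n - 1 - i) mod m) {..<m ^ n} ({..<n} \<rightarrow>\<^sub>E {..<m})"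
proof -
  let ?f = "\<lambda>x :: nat. \<lambda>i\<in>{..<n}. x div m ^ (n - 1 - i) mod m"
  have inj: "inj_on ?f {..<m ^ n}"
  proof (rule inj_onI)
    fix x y assume xy: "x \<in> {..<m ^ n}" "y \<in> {..<m ^ n}" and eq: "?f x = ?f y"
    show "x = y"
    proof (rule eq_of_digits_eq[of x m n])
      fix i assume "i < n"
      then show "x div m ^ i mod m = y div m ^ i mod m"
        \<comment> \<open>The substitution undoes the reversed order of the digits.\<close>
        using fun_cong[OF eq, of "n - 1 - i"] by simp
    qed (use xy in auto)
  qed
  moreover have "?f ` {..<m ^ n} \<subseteq> {..<n} \<rightarrow>\<^sub>E {..<m}"
    using assms by (intro image_subsetI restrict_PiE_iff[THEN iffD2]) auto
  then have "?f ` {..<m ^ n} = {..<n} \<rightarrow>\<^sub>E {..<m}"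
    using inj by (intro card_subset_eq finite_PiE) (auto simp: card_image card_PiE)
  ultimately show ?thesis by (simp add: bij_betw_def)
qed

text \<open>A diagonal position is traded for its quotient and remainder modulo \<open>n\<close>,
  and the quotient for its tuple of digits. Both reindexings are bijections, so multiplicities are
  kept.\<close>

lemma mset_diag_wreath_mat_diagonal:
  fixes A D :: "'a :: comm_ring_1 mat"
  assumes A: "A \<in> carrier_mat n n" "diagonal_mat A" and D: "D \<in> carrier_mat m m" "diagonal_mat D"
    and m: "m > 0"
  shows "mset (diag_mat (wreath_mat A D)) =
    (\<Sum>i \<in> {..<n} \<rightarrow>\<^sub>E {..<m}. \<Sum>k<n. {# A $$ (k, k) + D $$ (i k, i k) #})"
proof -
  define f where "f x k = {# A $$ (k, k) + D $$ (x div m ^ (n - 1 - k) mod m, x div m ^ (n - 1 - k) mod m) #}"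
    for x k
  have "mset (diag_mat (wreath_mat A D)) = (\<Sum>p<m ^ n * n. {# wreath_mat A D $$ (p, p) #})"
    using wreath_mat_carrier[OF A(1) D(1)]
    by (simp add: diag_mat_def sum_unfold_sum_mset mset_map[symmetric] mult.commute atLeast_upt
        image_mset.compositionality)
  also have "\<dots> = (\<Sum>p<m ^ n * n. f (p div n) (p mod n))"
    by (intro sum.cong refl) (simp add: f_def wreath_mat_diagonal(2)[OF A D] mult.commute)
  also have "\<dots> = (\<Sum>x<m ^ n. \<Sum>k<n. f x k)" by (rule sum_div_mod)
  also have "\<dots> = (\<Sum>x<m ^ n. \<Sum>k<n. {# A $$ (k, k) +
      D $$ ((\<lambda>i\<in>{..<n}. x div m ^ (n - 1 - i) mod m) k, (\<lambda>i\<in>{..<n}. x div m ^ (n - 1 - i) mod m) k) #})"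
    by (intro sum.cong refl) (simp add: f_def)
  also have "\<dots> = (\<Sum>i \<in> {..<n} \<rightarrow>\<^sub>E {..<m}. \<Sum>k<n. {# A $$ (k, k) + D $$ (i k, i k) #})"
    by (rule sum.reindex_bij_betw[OF bij_betw_digits[OF m],
        where g = "\<lambda>i. \<Sum>k<n. {# A $$ (k, k) + D $$ (i k, i k) #}"])
  finally show ?thesis .
qed

text \<open>Each value of the coordinate \<open>k\<close> is taken once for every choice of the
  other coordinates, that is \<open>card S ^ (card I - 1)\<close> times. This is the source of the
  exponent \<open>m ^ (n - 1)\<close> in the determinant.\<close>

lemma prod_PiE_component:
  fixes g :: "'b \<Rightarrow> 'a :: comm_semiring_1"
  assumes "finite I" "k \<in> I" "finite S"
  shows "(\<Prod>i \<in> I \<rightarrow>\<^sub>E S. g (i k)) = (\<Prod>x\<in>S. g x) ^ (card S ^ (card I - 1))"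
proof -
  define J where "J = I - {k}"
  have J: "I = insert k J" "k \<notin> J" "finite J" using assms by (auto simp: J_def)
  have "(\<Prod>i \<in> I \<rightarrow>\<^sub>E S. g (i k)) = (\<Prod>z\<in>S \<times> (J \<rightarrow>\<^sub>E S). g (fst z))"
    unfolding J(1) PiE_insert_eq
    by (subst prod.reindex) (auto simp: inj_combinator[OF J(2), of "\<lambda>_. S"] case_prod_beta)
  also have "\<dots> = (\<Prod>x\<in>S. \<Prod>i\<in>J \<rightarrow>\<^sub>E S. g x)"
    unfolding prod.cartesian_product by (rule prod.cong) auto
  also have "\<dots> = (\<Prod>x\<in>S. g x) ^ (card S ^ card J)"
    using J(3) by (simp add: card_PiE prod_power_distrib[symmetric])
  finally show ?thesis using J by simp
qed

section \<open>Fourier diagonalisation of the all-ones matrix\<close>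

lemma sum_root_unity_powers:
  fixes k m :: nat
  assumes m: "m > 0" and \<rho>: "\<rho> = exp (2 * complex_of_real pi * \<i> / of_nat m)"
  shows "(\<Sum>j<m. \<rho> ^ (j * k)) = (if m dvd k then of_nat m else 0)"
proof -
  have pow1: "\<rho> ^ k = 1 \<longleftrightarrow> m dvd k" for k
  proof -
    have "\<rho> ^ k = exp (2 * of_real pi * \<i> * of_nat k / of_nat m)"
      unfolding \<rho> by (simp add: exp_of_nat_mult[symmetric] mult_ac)
    then show ?thesis using complex_root_unity_eq_1[of m k] m by simp
  qed
  \<comment> \<open>The sum is geometric with ratio \<open>\<rho> ^ k\<close>, an
    \<open>m\<close>-th root of unity. If the ratio is 1, all \<open>m\<close> terms are 1;
    otherwise the numerator of the closed form vanishes.\<close>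
  have "(\<rho> ^ k) ^ m = 1" using pow1[of "k * m"] by (simp add: power_mult)
  then have "(\<Sum>j<m. (\<rho> ^ k) ^ j) = (if m dvd k then of_nat m else 0)"
    using pow1[of k] by (auto simp: sum_gp_strict)
  then show ?thesis by (simp add: power_mult[symmetric] mult.commute)
qed

text \<open>The columns of the Fourier matrix are eigenvectors: the all-ones matrix sends column
  \<open>y\<close> to the constant vector of its column sum, which is 0 for \<open>y\<close> other
  than 0, while column 0 is itself constant.\<close>

lemma similar_mat_all_ones:
  assumes m: "m > 0" and \<rho>: "\<rho> = exp (2 * complex_of_real pi * \<i> / of_nat m)"
  shows "similar_mat (h \<cdot>\<^sub>m all_ones_mat m)
    (mat m m (\<lambda>(x, y). if x = y then h * (\<Sum>j<m. \<rho> ^ (j * x)) else 0))"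
    (is "similar_mat ?B ?D")
proof -
  define P where "P = mat m m (\<lambda>(x, y). \<rho> ^ (x * y))"
  \<comment> \<open>The inverse Fourier matrix. As \<rho> is an \<open>m\<close>-th root of unity,
    the exponent \<open>x * (m - y)\<close> stands for \<open>- x * y\<close> without negative
    powers.\<close>
  define Q where "Q = mat m m (\<lambda>(x, y). \<rho> ^ (x * (m - y)) / of_nat m)"
  note geo = sum_root_unity_powers[OF m \<rho>]
  have PQ: "P * Q = 1\<^sub>m m"
  proof (rule eq_matI)
    fix x z assume "x < dim_row (1\<^sub>m m :: complex mat)" "z < dim_col (1\<^sub>m m :: complex mat)"
    then have xz: "x < m" "z < m" by auto
    have "(P * Q) $$ (x, z) = (\<Sum>j<m. \<rho> ^ (j * (x + (m - z)))) / of_nat m"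
      using xz by (simp add: P_def Q_def scalar_prod_def lessThan_atLeast0 sum_divide_distrib
          power_add[symmetric] algebra_simps)
    also have "m dvd x + (m - z) \<longleftrightarrow> x = z"
    proof
      assume "m dvd x + (m - z)"
      then obtain c where c: "x + (m - z) = m * c" by blast
      \<comment> \<open>Strictly between 0 and \<open>2 * m\<close> the only multiple of
        \<open>m\<close> is \<open>m\<close> itself.\<close>
      have "0 < m * c" "m * c < m * 2" using c xz by linarith+
      then have "c = 1" using m by simp
      then show "x = z" using c xz by simp
    qed (use xz in simp)
    then have "(\<Sum>j<m. \<rho> ^ (j * (x + (m - z)))) / of_nat m = (1\<^sub>m m :: complex mat) $$ (x, z)"
      using m xz by (simp add: geo)
    finally show "(P * Q) $$ (x, z) = (1\<^sub>m m :: complex mat) $$ (x, z)" .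
  qed (auto simp: P_def Q_def)
  have c: "P \<in> carrier_mat m m" "Q \<in> carrier_mat m m" "?B \<in> carrier_mat m m" "?D \<in> carrier_mat m m"
    by (auto simp: P_def Q_def all_ones_mat_def)
  have BP: "?B * P = P * ?D"
  proof (rule eq_matI)
    fix x y assume "x < dim_row (P * ?D)" "y < dim_col (P * ?D)"
    then have xy: "x < m" "y < m" by (auto simp: P_def)
    have "(?B * P) $$ (x, y) = h * (\<Sum>j<m. \<rho> ^ (j * y))"
      using xy by (simp add: P_def all_ones_mat_def scalar_prod_def lessThan_atLeast0 sum_distrib_left)
    moreover have "(P * ?D) $$ (x, y) = (\<Sum>j<m. if j = y then \<rho> ^ (x * y) * (h * (\<Sum>j<m. \<rho> ^ (j * y))) else 0)"
    proof -
      have "(P * ?D) $$ (x, y) = (\<Sum>j<m. \<rho> ^ (x * j) * (if j = y then h * (\<Sum>i<m. \<rho> ^ (i * j)) else 0))"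
        using xy by (simp add: P_def scalar_prod_def lessThan_atLeast0)
      also have "\<dots> = (\<Sum>j<m. if j = y then \<rho> ^ (x * y) * (h * (\<Sum>j<m. \<rho> ^ (j * y))) else 0)"
        by (intro sum.cong refl) auto
      finally show ?thesis .
    qed
    \<comment> \<open>The two entries differ by the factor \<open>\<rho> ^ (x * y)\<close>, which is
      1 for \<open>y = 0\<close>; for any other \<open>y\<close> the sum vanishes.\<close>
    moreover have "m dvd y \<longleftrightarrow> y = 0" using xy by (auto dest: dvd_imp_le)
    ultimately show "(?B * P) $$ (x, y) = (P * ?D) $$ (x, y)"
      using xy by (simp add: geo)
  qed (auto simp: P_def all_ones_mat_def)
  have "?B = ?B * (P * Q)" unfolding PQ by (rule right_mult_one_mat[OF c(3), symmetric])
  also have "\<dots> = P * ?D * Q" unfolding BP[symmetric] by (rule assoc_mult_mat[OF c(3,1,2), symmetric])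
  \<comment> \<open>A right inverse of a square matrix over a field is two-sided, which supplies
    \<open>Q * P\<close>.\<close>
  finally have "similar_mat_wit ?B ?D P Q"
    by (rule similar_mat_witI[OF PQ mat_mult_left_right_inverse[OF c(1,2) PQ] _ c(3,4,1,2)])
  then show ?thesis unfolding similar_mat_def by blast
qed

section \<open>The spectrum and the determinant\<close>

lemma proots_prod_list_linear:
  "proots (\<Prod>a\<leftarrow>as. [:- a, 1 :: 'a :: idom:]) = mset as"
proof (induction as)
  case (Cons a as)
  have "(\<Prod>a\<leftarrow>as. [:- a, 1 :: 'a:]) \<noteq> 0" by (auto simp: prod_list_zero_iff)
  then have "proots ([:- a, 1:] * (\<Prod>a\<leftarrow>as. [:- a, 1:])) = {#a#} + mset as"
    using Cons by (subst proots_mult) auto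
  then show ?case by simp
qed simp

theorem theorem5p4:
  fixes n m :: nat and A B :: "complex mat" and a :: "nat \<Rightarrow> complex" and h \<rho> :: complex
  assumes "n > 0" and "m > 0"
    and "A \<in> carrier_mat n n" and "diagonal_mat A" and "\<And>k. k < n \<Longrightarrow> A $$ (k, k) = a k"
    and "B = h \<cdot>\<^sub>m all_ones_mat m"
    and "\<rho> = exp (2 * complex_of_real pi * \<i> / of_nat m)"
  shows "spectrum_mset (wreath_mat A B) =
           (\<Sum>i \<in> {..<n} \<rightarrow>\<^sub>E {..<m}. \<Sum>k<n. {# a k + h * (\<Sum>j<m. \<rho> ^ (j * i k)) #})
       \<and> det (wreath_mat A B) =
           (\<Prod>k<n. (a k + of_nat m * h) ^ (m ^ (n - 1)) * a k ^ ((m - 1) * m ^ (n - 1)))"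
proof -
  \<comment> \<open>These sums stay unevaluated for the spectrum, which is stated in terms of them;
    their values enter only in the determinant.\<close>
  define s where "s x = (\<Sum>j<m. \<rho> ^ (j * x))" for x :: nat
  define D where "D = mat m m (\<lambda>(x, y). if x = y then h * s x else 0)"
  have B: "B \<in> carrier_mat m m" using assms(6) by (simp add: all_ones_mat_def)
  have D: "D \<in> carrier_mat m m" "diagonal_mat D" by (auto simp: D_def diagonal_mat_def)
  have sim: "similar_mat (wreath_mat A B) (wreath_mat A D)"
    using similar_mat_wreath_mat[OF assms(3) B] similar_mat_all_ones[OF assms(2,7), of h]
    unfolding assms(6) D_def s_def .
  have W: "wreath_mat A D \<in> carrier_mat (n * m ^ n) (n * m ^ n)" by (rule wreath_mat_carrier[OF assms(3) D(1)])
  have up: "upper_triangular (wreath_mat A D)"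
    using wreath_mat_diagonal(1)[OF assms(3,4) D] W by (auto simp: diagonal_mat_def)
  have diag: "mset (diag_mat (wreath_mat A D)) = (\<Sum>i \<in> {..<n} \<rightarrow>\<^sub>E {..<m}. \<Sum>k<n. {# a k + h * s (i k) #})"
    unfolding mset_diag_wreath_mat_diagonal[OF assms(3,4) D assms(2)]
  proof (intro sum.cong refl)
    fix i k assume "i \<in> {..<n} \<rightarrow>\<^sub>E {..<m}" "k \<in> {..<n}"
    then have "i k < m" "k < n" by (auto dest: PiE_mem)
    then show "{# A $$ (k, k) + D $$ (i k, i k) #} = {# a k + h * s (i k) #}"
      by (simp add: D_def assms(5))
  qed
  \<comment> \<open>Similar matrices share their characteristic polynomial, and that of a triangular
    matrix is the product of the linear factors given by its diagonal.\<close>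
  have "spectrum_mset (wreath_mat A B) = mset (diag_mat (wreath_mat A D))"
    unfolding spectrum_mset_def char_poly_similar[OF sim] char_poly_upper_triangular[OF W up]
    by (rule proots_prod_list_linear)
  moreover have "det (wreath_mat A B) =
           (\<Prod>k<n. (a k + of_nat m * h) ^ (m ^ (n - 1)) * a k ^ ((m - 1) * m ^ (n - 1)))"
  proof -
    \<comment> \<open>Multiset sums become products, so the determinant can be read off the diagonal
      multiset already computed in \<open>diag\<close>.\<close>
    have hom: "prod_mset (\<Sum>i\<in>I. f i) = (\<Prod>i\<in>I. prod_mset (f i))"
      for I :: "'i set" and f :: "'i \<Rightarrow> complex multiset"
      by (induction I rule: infinite_finite_induct) auto
    have "det (wreath_mat A B) = prod_mset (mset (diag_mat (wreath_mat A D)))"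
      using det_similar[OF sim] det_upper_triangular[OF up W] by (simp add: prod_mset_prod_list)
    also have "\<dots> = (\<Prod>i \<in> {..<n} \<rightarrow>\<^sub>E {..<m}. \<Prod>k<n. a k + h * s (i k))"
      unfolding diag hom by simp
    \<comment> \<open>After the exchange the inner product involves a single coordinate of
      \<open>i\<close>, as \<open>prod_PiE_component\<close> requires.\<close>
    also have "\<dots> = (\<Prod>k<n. \<Prod>i \<in> {..<n} \<rightarrow>\<^sub>E {..<m}. a k + h * s (i k))"
      by (rule prod.swap)
    also have "\<dots> = (\<Prod>k<n. (\<Prod>x<m. a k + h * s x) ^ (m ^ (n - 1)))"
      by (intro prod.cong refl)
        (subst prod_PiE_component[where g = "\<lambda>x. _ + h * s x"], auto)
    finally have det: "det (wreath_mat A B) = (\<Prod>k<n. (\<Prod>x<m. a k + h * s x) ^ (m ^ (n - 1)))" .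
    \<comment> \<open>Only \<open>x = 0\<close> contributes a term in \<open>h\<close>, with
      \<open>s 0\<close> equal to \<open>m\<close>; the other \<open>m - 1\<close> factors are
      \<open>a k\<close>.\<close>
    have "(\<Prod>x<m. a k + h * s x) = (a k + of_nat m * h) * a k ^ (m - 1)" for k
    proof -
      have "s x = 0" if "0 < x" "x < m" for x
        using that sum_root_unity_powers[OF assms(2,7), of x] by (auto simp: s_def dest: dvd_imp_le)
      then have "(\<Prod>x\<in>{..<m} - {0}. a k + h * s x) = (\<Prod>x\<in>{..<m} - {0}. a k)"
        by (intro prod.cong refl) auto
      then show ?thesis
        using assms(2) by (subst prod.remove[of _ 0]) (auto simp: s_def mult.commute)
    qed
    then show ?thesis unfolding det by (simp add: power_mult_distrib power_mult[symmetric])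
  qed
  ultimately show ?thesis by (simp add: diag s_def)
qed

end
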